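(* The function $a \mapsto \ln a$ is strictly increasing on $\{a \in \mathbb{R} : a > 0\}$, where $\ln a$ is defined as the derivative at $x = 0$ of $x \mapsto a^x$.
   Context: For real $a > 0$, $a^x$ ($x \in \mathbb{R}$) is the continuous extension to $\mathbb{R}$ of the function $q \mapsto a^q$ defined on $\mathbb{Q}$ (rational powers). Equivalently, $a^x = \sup\{a^q : q \in \mathbb{Q},\ q < x\}$ if $a \ge 1$, and $a^x = \inf\{a^q : q \in \mathbb{Q},\ q < x\}$ if $0 < a < 1$. For every real $a>0$ the function $x \mapsto a^x$ is differentiable at $0$, and $\ln : (0,\infty) \to \mathbb{R}$ is defined by $\ln a = \left.\frac{d}{dx} a^x\right|_{x=0}$, i.e. $\ln a = \lim_{h \to 0} \frac{a^h - 1}{h}$. *)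

theory Defs
  imports "HOL-Analysis.Analysis"
begin

text \<open>
  The library's \<^term>\<open>(powr)\<close> is defined from \<^term>\<open>exp\<close> and \<^term>\<open>ln\<close>. Here real powers are built
  from rational powers instead, and the logarithm from the real powers.
\<close>

text \<open>For \<open>a > 0\<close> and \<open>q = m / n\<close> in lowest terms with \<open>n > 0\<close>: the \<open>n\<close>-th root of \<open>a ^ m\<close>.\<close>

definition rat_power :: "real \<Rightarrow> rat \<Rightarrow> real" where
  "rat_power a q = (case quotient_of q of (m, n) \<Rightarrow> root (nat n) (a powi m))"

text \<open>
  The continuous extension of \<open>q \<mapsto> a ^ q\<close> from the rationals to the reals. It is meaningful for
  \<open>a > 0\<close>, where it exists and is unique (lemma \<open>ex1_continuous_extension_rat_power\<close>).
\<close>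

definition real_power :: "real \<Rightarrow> real \<Rightarrow> real" where
  "real_power a = (THE f. continuous_on UNIV f \<and> (\<forall>q. f (of_rat q) = rat_power a q))"

text \<open>
  The derivative at \<open>0\<close>, which exists for \<open>a > 0\<close> (lemma \<open>real_power_differentiable_at_0\<close>).
\<close>

definition natlog :: "real \<Rightarrow> real" where
  "natlog a = deriv (\<lambda>x. real_power a x) 0"

lemma rat_power_eq_powr:
  assumes "a > 0"
  shows "rat_power a q = a powr (of_rat q)"
proof -
  obtain m n where mn: "quotient_of q = (m, n)" by (cases "quotient_of q") auto
  have n: "n > 0" using quotient_of_denom_pos[OF mn] .
  have q: "(of_rat q :: real) = of_int m / of_int n"
    using quotient_of_div[OF mn] by (simp add: of_rat_divide)
  have "rat_power a q = root (nat n) (a powr of_int m)"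
    using assms by (simp add: rat_power_def mn powr_real_of_int')
  also have "\<dots> = a powr (of_int m / of_int n)"
    using n assms by (simp add: root_powr_inverse powr_powr field_simps)
  finally show ?thesis by (simp add: q)
qed

lemma ex1_continuous_extension_rat_power:
  assumes "a > 0"
  shows "\<exists>!f::real \<Rightarrow> real. continuous_on UNIV f \<and> (\<forall>q. f (of_rat q) = rat_power a q)"
proof (rule ex1I[of _ "\<lambda>x. a powr x"])
  show "continuous_on UNIV (\<lambda>x. a powr x) \<and> (\<forall>q. a powr of_rat q = rat_power a q)"
    using assms by (auto simp: rat_power_eq_powr intro!: continuous_intros)
next
  fix f :: "real \<Rightarrow> real"
  assume f: "continuous_on UNIV f \<and> (\<forall>q. f (of_rat q) = rat_power a q)"
  have "f x - a powr x = 0" for x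
  proof (rule continuous_constant_on_closure[where S = "\<rat>" and f = "\<lambda>x. f x - a powr x"])
    show "continuous_on (closure \<rat>) (\<lambda>x. f x - a powr x)"
      using f assms by (auto simp: Rats_closure_real intro!: continuous_intros)
    show "f y - a powr y = 0" if "y \<in> \<rat>" for y
      using that f assms by (auto simp: rat_power_eq_powr elim!: Rats_cases)
  qed (simp add: Rats_closure_real)
  then show "f = (\<lambda>x. a powr x)" by auto
qed

lemma real_power_differentiable_at_0:
  assumes "a > 0"
  shows "(\<lambda>x. real_power a x) field_differentiable (at 0)"
proof -
  have "real_power a = (\<lambda>x. a powr x)"
    unfolding real_power_def
    by (rule the1_equality[OF ex1_continuous_extension_rat_power[OF assms]])
      (use assms in \<open>auto simp: rat_power_eq_powr intro!: continuous_intros\<close>)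
  moreover have "((\<lambda>x. a powr x) has_real_derivative ln a) (at 0)"
    using assms by (auto intro!: derivative_eq_intros)
  ultimately show ?thesis by (auto simp: field_differentiable_def)
qed

end

theory Submission
  imports Defs
begin

text \<open>For \<open>a > 0\<close> the continuous extension of rational powers is unique, so it is
  \<open>powr\<close>. Hence \<open>natlog\<close> is the library's \<open>ln\<close> on positive
  reals (\<open>natlog_eq_ln\<close>), which is strictly increasing.\<close>

lemma real_power_eq_powr:
  assumes "a > 0"
  shows "real_power a = (\<lambda>x. a powr x)"
  unfolding real_power_def
  by (rule the1_equality[OF ex1_continuous_extension_rat_power[OF assms]])
    \<comment> \<open>It remains that \<open>powr\<close> is itself a continuous extension.\<close>
    (use assms in \<open>auto simp: rat_power_eq_powr intro!: continuous_intros\<close>)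

lemma natlog_eq_ln:
  assumes "a > 0"
  shows "natlog a = ln a"
proof -
  \<comment> \<open>The derivative is \<open>a powr x * ln a\<close>, and
    \<open>a powr 0 = 1\<close> since \<open>a\<close> is nonzero.\<close>
  have "((\<lambda>x. a powr x) has_real_derivative ln a) (at 0)"
    using assms by (auto intro!: derivative_eq_intros)
  then show ?thesis
    unfolding natlog_def real_power_eq_powr[OF assms] by (rule DERIV_imp_deriv)
qed

theorem corollary3p15:
  shows "strict_mono_on {a :: real. a > 0} (\<lambda>a. natlog a)"
  by (rule strict_mono_onI) (simp add: natlog_eq_ln)

end
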